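(* Let $X$ be a real Hilbert space whose dual space $X^*$ is identified with $X$. Let $M:X\to X$ be a bounded linear operator with closed range, let $q\in X$, and let $C\subset X$ be a nonempty polyhedral convex set, that is, $C=\{x\in X : \langle x_i^*,x\rangle\le \alpha_i,\ i=1,\dots,m\}$ for some $x_i^*\in X$ and $\alpha_i\in\mathbb{R}$, $i=1,\dots,m$. Let $$C^*=\{\bar x\in C : \langle M\bar x+q,\,x-\bar x\rangle\ge 0\ \text{ for all } x\in C\}$$ be the solution set of the affine variational inequality defined by $\{M,q,C\}$. Then there exist constants $\varepsilon>0$ and $c>0$ such that $$d(x,C^* )\le c\,\|x-P_C(x-Mx-q)\|$$ for every $x\in X$ satisfying $\|x-P_C(x-Mx-q)\|\le\varepsilon$.
   Context: $P_C(u)$ denotes the metric projection of $u\in X$ on $C$, i.e. the unique point of the nonempty closed convex set $C$ nearest to $u$. $d(x,A)=\inf_{a\in A}\|x-a\|$ denotes the distance from $x$ to the set $A$, with the convention $d(x,\emptyset)=+\infty$ (the set $C^*$ is not assumed to be nonempty). *)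

theory Defs
  imports "HOL-Analysis.Analysis"
begin

(* The library's closest_point is restricted to the class heine_borel, which excludes
   infinite-dimensional Hilbert spaces.  Here the nearest point exists and is unique whenever
   C is nonempty, closed and convex and the space is complete. *)
definition metric_proj :: "'a::real_inner set \<Rightarrow> 'a \<Rightarrow> 'a" where
  "metric_proj C u = (THE p. p \<in> C \<and> (\<forall>y\<in>C. norm (u - p) \<le> norm (u - y)))"

(* Values in ereal make the distance to the empty set \<infinity>; the library's infdist would give 0. *)
definition ext_infdist :: "'a::real_normed_vector \<Rightarrow> 'a set \<Rightarrow> ereal" where
  "ext_infdist x A = (INF a\<in>A. ereal (norm (x - a)))"

lemma ext_infdist_empty: "ext_infdist x {} = \<infinity>"
  by (simp add: ext_infdist_def top_ereal_def)

definition avi_solutions :: "('a::real_inner \<Rightarrow> 'a) \<Rightarrow> 'a \<Rightarrow> 'a set \<Rightarrow> 'a set" where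
  "avi_solutions M q C = {xb \<in> C. \<forall>x\<in>C. inner (M xb + q) (x - xb) \<ge> 0}"

end

theory Submission
  imports Defs "HOL-Probability.Discrete_Topology"
begin

text \<open>
  Let \<open>p\<close> be the projection of \<open>x - M x - q\<close> on \<open>C\<close> and \<open>r = x - p\<close> the natural residual. The vector
  \<open>x - M x - q - p = r - (M x + q)\<close> is normal to \<open>C\<close> at \<open>p\<close>, so by Farkas' lemma (\<open>polyhedron_normal_cone\<close>) it is a
  nonnegative combination of the constraint vectors that are active at \<open>p\<close>. Hence \<open>x\<close> together with the
  multipliers solves the KKT system of the variational inequality for some active set \<open>I\<close>, with all
  right-hand sides perturbed by amounts of order \<open>\<parallel>r\<parallel>\<close>. Exact solutions of such a system solve the
  variational inequality.

  For fixed \<open>I\<close> the KKT system is linear: a linear equation in the Hilbert space together with finitely many scalar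
  equations and inequalities. It therefore suffices that solutions of a slightly perturbed system lie near
  solutions of the exact one, with a distance linear in the perturbation and with the understanding that for small
  perturbations the perturbed system is unsolvable if the exact one is (\<open>upper_lipschitz\<close>). As there are
  finitely many active sets, the constants can be chosen uniformly.

  This stability is built up constraint by constraint. The linear equation is stable because its
  operator, which combines \<open>M\<close> with the finitely many constraint vectors, has closed range, so that the open mapping
  theorem supplies preimages of controlled size (\<open>closed_range_bounded_preimages\<close>). A scalar equation preserves
  stability because the exact solution set is affine (\<open>upper_lipschitz_equality\<close>), and an inequality preserves
  it because, where it is violated, it can be treated as an equation (\<open>upper_lipschitz_inequality\<close>).
\<close>

section \<open>Nearest points in a Hilbert space\<close>

text \<open>
  By the parallelogram law a minimizing sequence is Cauchy, since midpoints of its members lie in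
  \<open>C\<close> and so cannot be much nearer to \<open>u\<close> than the members themselves.
\<close>
lemma nearest_point_exists:
  fixes C :: "'a::{real_inner, complete_space} set"
  assumes "closed C" "convex C" "C \<noteq> {}"
  shows "\<exists>p\<in>C. \<forall>y\<in>C. norm (u - p) \<le> norm (u - y)"
proof -
  define \<delta> where "\<delta> = (INF y\<in>C. (norm (u - y))\<^sup>2)"
  have bdd: "bdd_below ((\<lambda>y. (norm (u - y))\<^sup>2) ` C)"
    by (intro bdd_belowI[of _ 0]) auto
  have lower: "\<delta> \<le> (norm (u - y))\<^sup>2" if "y \<in> C" for y
    unfolding \<delta>_def using bdd that by (rule cINF_lower)
  have "\<exists>y\<in>C. (norm (u - y))\<^sup>2 < \<delta> + inverse (real (Suc n))" for n
  proof -
    have "\<delta> < \<delta> + inverse (real (Suc n))" by simp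
    then show ?thesis
      unfolding \<delta>_def using cINF_less_iff[OF assms(3) bdd] by blast
  qed
  then obtain s where s: "\<And>n. s n \<in> C" "\<And>n. (norm (u - s n))\<^sup>2 < \<delta> + inverse (real (Suc n))"
    by metis
  have close: "(norm (s m - s n))\<^sup>2 \<le> 2 * inverse (real (Suc m)) + 2 * inverse (real (Suc n))" for m n
  proof -
    have "(1/2) *\<^sub>R s m + (1/2) *\<^sub>R s n \<in> C"
      using assms(2) s(1) by (auto simp: convex_def)
    then have "\<delta> \<le> (norm (u - ((1/2) *\<^sub>R s m + (1/2) *\<^sub>R s n)))\<^sup>2"
      by (rule lower)
    moreover have "(norm (s m - s n))\<^sup>2 = 2 * (norm (u - s m))\<^sup>2 + 2 * (norm (u - s n))\<^sup>2
        - 4 * (norm (u - ((1/2) *\<^sub>R s m + (1/2) *\<^sub>R s n)))\<^sup>2"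
      by (simp add: power2_norm_eq_inner algebra_simps inner_commute)
    ultimately show ?thesis using s(2)[of m] s(2)[of n] by linarith
  qed
  have "Cauchy s"
  proof (rule CauchyI)
    fix e :: real assume e: "0 < e"
    then have "0 < e\<^sup>2 / 4" by simp
    then obtain N where N: "inverse (real (Suc N)) < e\<^sup>2 / 4"
      using reals_Archimedean by blast
    have "norm (s m - s n) < e" if mn: "m \<ge> N" "n \<ge> N" for m n
    proof -
      have small: "inverse (real (Suc k)) < e\<^sup>2 / 4" if "k \<ge> N" for k
      proof -
        have "inverse (real (Suc k)) \<le> inverse (real (Suc N))"
          using that by (intro le_imp_inverse_le) auto
        with N show ?thesis by linarith
      qed
      then have "(norm (s m - s n))\<^sup>2 < e\<^sup>2" using close[of m n] small[OF mn(1)] small[OF mn(2)] by linarith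
      then show ?thesis using e by (simp add: power_less_imp_less_base)
    qed
    then show "\<exists>M. \<forall>m\<ge>M. \<forall>n\<ge>M. norm (s m - s n) < e" by blast
  qed
  then obtain p where p: "s \<longlonglongrightarrow> p"
    using Cauchy_convergent convergent_def by blast
  have pC: "p \<in> C"
    using closed_sequentially[OF assms(1) _ p] s(1) by blast
  have "(\<lambda>n. (norm (u - s n))\<^sup>2) \<longlonglongrightarrow> (norm (u - p))\<^sup>2"
    by (intro tendsto_intros p)
  moreover have "(\<lambda>n. \<delta> + inverse (real (Suc n))) \<longlonglongrightarrow> \<delta> + 0"
    by (intro tendsto_intros LIMSEQ_inverse_real_of_nat)
  ultimately have "(norm (u - p))\<^sup>2 \<le> \<delta>"
    using less_imp_le[OF s(2)] by (intro LIMSEQ_le) auto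
  then have "norm (u - p) \<le> norm (u - y)" if "y \<in> C" for y
    using lower[OF that] by (meson order_trans power2_le_imp_le norm_ge_zero)
  with pC show ?thesis by blast
qed

text \<open>
  Otherwise a short step from \<open>p\<close> towards \<open>y\<close> would stay in \<open>C\<close> and come strictly nearer to \<open>u\<close>.
\<close>
lemma nearest_point_variational:
  fixes C :: "'a::real_inner set"
  assumes "convex C" "p \<in> C" "\<And>y. y \<in> C \<Longrightarrow> norm (u - p) \<le> norm (u - y)" "y \<in> C"
  shows "inner (u - p) (y - p) \<le> 0"
proof (rule ccontr)
  define d where "d = y - p"
  \<comment> \<open>The minimizer over [0, 1] of the distance from u to p + t d.\<close>
  define t where "t = min 1 (inner (u - p) d / (norm d)\<^sup>2)"
  assume "\<not> inner (u - p) (y - p) \<le> 0"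
  then have pos: "inner (u - p) d > 0" and d: "d \<noteq> 0"
    by (auto simp: d_def)
  then have t: "t > 0" "t \<le> 1" "t * (norm d)\<^sup>2 \<le> inner (u - p) d"
    by (auto simp: t_def min_def field_simps)
  have "p + t *\<^sub>R d = (1 - t) *\<^sub>R p + t *\<^sub>R y"
    by (simp add: d_def algebra_simps)
  then have "p + t *\<^sub>R d \<in> C"
    using assms(1,2,4) t by (simp add: convex_alt)
  then have "(norm (u - p))\<^sup>2 \<le> (norm (u - (p + t *\<^sub>R d)))\<^sup>2"
    using assms(3) by (simp add: power_mono)
  also have "\<dots> = (norm (u - p))\<^sup>2 - 2 * t * inner (u - p) d + t * (t * (norm d)\<^sup>2)"
    by (simp add: power2_norm_eq_inner algebra_simps inner_commute)
  also have "\<dots> \<le> (norm (u - p))\<^sup>2 - 2 * t * inner (u - p) d + t * inner (u - p) d"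
    using t by simp
  finally have "t * inner (u - p) d \<le> 0" by simp
  then show False using t pos by (simp add: mult_le_0_iff)
qed

text \<open>
  Existence makes the definite description in \<open>metric_proj\<close> meaningful once the nearest point is
  known to be unique; adding the variational inequalities of two nearest points shows that they agree.
\<close>
lemma metric_proj_in_and_variational:
  fixes C :: "'a::{real_inner, complete_space} set"
  assumes "closed C" "convex C" "C \<noteq> {}"
  shows "metric_proj C u \<in> C"
    and "\<And>y. y \<in> C \<Longrightarrow> inner (u - metric_proj C u) (y - metric_proj C u) \<le> 0"
proof -
  let ?P = "\<lambda>p. p \<in> C \<and> (\<forall>y\<in>C. norm (u - p) \<le> norm (u - y))"
  obtain p where p: "?P p" using nearest_point_exists[OF assms] by blast
  have "p' = p" if p': "?P p'" for p'
  proof -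
    have "inner (u - p) (p' - p) \<le> 0" "inner (u - p') (p - p') \<le> 0"
      using nearest_point_variational[OF assms(2)] p p' by auto
    then have "inner (p' - p) (p' - p) \<le> 0"
      by (simp add: algebra_simps inner_commute)
    then show ?thesis using inner_gt_zero_iff[of "p' - p"] by (metis not_less right_minus_eq)
  qed
  with p have "?P (metric_proj C u)"
    unfolding metric_proj_def by (rule theI)
  then show "metric_proj C u \<in> C"
    and "\<And>y. y \<in> C \<Longrightarrow> inner (u - metric_proj C u) (y - metric_proj C u) \<le> 0"
    using nearest_point_variational[OF assms(2)] by auto
qed

text \<open>
  With \<open>n\<close> the component of \<open>v\<close> orthogonal to \<open>span S\<close>, a point lies in the enlarged span exactly
  when removing its component along \<open>n\<close> leaves a point of \<open>span S\<close>. This describes the enlarged span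
  as the preimage of a closed set under a continuous map, also when \<open>n = 0\<close>.
\<close>
lemma closed_span_insert:
  fixes S :: "'a::{real_inner, complete_space} set"
  assumes "closed (span S)"
  shows "closed (span (insert v S))"
proof -
  define p where "p = metric_proj (span S) v"
  define n where "n = v - p"
  have "convex (span S)" "span S \<noteq> {}"
    using span_zero[of S] by (auto simp: subspace_imp_convex simp del: span_zero)
  note proj = metric_proj_in_and_variational[OF assms this, where u = v]
  have p: "p \<in> span S" and var: "\<And>y. y \<in> span S \<Longrightarrow> inner n (y - p) \<le> 0"
    unfolding p_def n_def by (fact proj)+
  have orth: "inner n y = 0" if y: "y \<in> span S" for y
    using var[of "p + y"] var[of "p - y"] p y by (auto simp: span_add span_diff)
  have "span (insert v S) = {x. x - (inner n x / inner n n) *\<^sub>R n \<in> span S}"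
  proof safe
    fix x assume "x \<in> span (insert v S)"
    then obtain k where "x - k *\<^sub>R v \<in> span S" by (auto simp: span_insert)
    then have "x - k *\<^sub>R v + k *\<^sub>R p \<in> span S"
      using p by (intro span_add span_scale)
    then have k: "x - k *\<^sub>R n \<in> span S" by (simp add: n_def algebra_simps)
    then have "inner n x = k * inner n n"
      using orth[OF k] by (simp add: inner_diff_right)
    then have "(inner n x / inner n n) *\<^sub>R n = k *\<^sub>R n"
      by (cases "n = 0") auto
    with k show "x - (inner n x / inner n n) *\<^sub>R n \<in> span S"
      by metis
  next
    fix x assume x: "x - (inner n x / inner n n) *\<^sub>R n \<in> span S"
    define k where "k = inner n x / inner n n"
    have "x - k *\<^sub>R n - k *\<^sub>R p \<in> span S"
      using x unfolding k_def[symmetric] by (rule span_diff[OF _ span_scale[OF p]])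
    then have "x - k *\<^sub>R v \<in> span S" by (simp add: n_def algebra_simps)
    then show "x \<in> span (insert v S)" by (auto simp: span_insert)
  qed
  moreover have "closed ((\<lambda>x. x - (inner n x / inner n n) *\<^sub>R n) -` span S)"
    by (intro continuous_closed_vimage assms) (auto intro!: continuous_intros simp: divide_inverse)
  ultimately show ?thesis by (simp add: vimage_def)
qed

lemma closed_span_Un_finite:
  fixes S :: "'a::{real_inner, complete_space} set"
  assumes "closed (span S)" "finite B"
  shows "closed (span (S \<union> B))"
  using assms(2)
  by (induction B) (auto simp: assms(1) closed_span_insert)

section \<open>Operators with closed range\<close>

text \<open>
  Successive approximation: the residuals are halved at each step, so the corrections form a
  geometrically convergent series whose sum is an exact preimage.
\<close>
lemma bounded_preimages_of_approximate:
  fixes T :: "'y::{real_normed_vector, complete_space} \<Rightarrow> 'z::real_normed_vector"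
  assumes T: "bounded_linear T" and L: "L \<ge> 0"
    and approx: "\<And>v. v \<in> range T \<Longrightarrow> \<exists>a. norm a \<le> L * norm v \<and> norm (v - T a) \<le> norm v / 2"
    and u: "u \<in> range T"
  shows "\<exists>w. T w = u \<and> norm w \<le> 2 * L * norm u"
proof -
  interpret T: bounded_linear T by (rule T)
  obtain g where g: "\<And>v. v \<in> range T \<Longrightarrow> norm (g v) \<le> L * norm v"
      "\<And>v. v \<in> range T \<Longrightarrow> norm (v - T (g v)) \<le> norm v / 2"
    using approx by metis
  define r where "r = rec_nat u (\<lambda>_ v. v - T (g v))"
  have r0: "r 0 = u" and rS: "\<And>n. r (Suc n) = r n - T (g (r n))"
    by (auto simp: r_def)
  have rR: "r n \<in> range T" for n
  proof (induction n)
    case (Suc n)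
    then obtain a where "r n = T a" by blast
    then have "r (Suc n) = T (a - g (r n))" by (simp add: rS T.diff)
    then show ?case by blast
  qed (use u r0 in auto)
  have rn: "norm (r n) \<le> norm u / 2 ^ n" for n
  proof (induction n)
    case (Suc n)
    then show ?case using g(2)[OF rR[of n]] by (simp add: rS)
  qed (simp add: r0)
  define s where "s n = (\<Sum>k<n. g (r k))" for n
  have Ts: "T (s n) = u - r n" for n
    by (induction n) (simp_all add: s_def r0 rS T.add)
  have diff: "norm (s (n + k) - s n) \<le> 2 * L * norm u * (1 / 2 ^ n - 1 / 2 ^ (n + k))" for n k
  proof (induction k)
    case (Suc k)
    have "s (n + Suc k) - s n = (s (n + k) - s n) + g (r (n + k))"
      by (simp add: s_def)
    then have "norm (s (n + Suc k) - s n) \<le> norm (s (n + k) - s n) + norm (g (r (n + k)))"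
      by (metis norm_triangle_ineq)
    also have "norm (g (r (n + k))) \<le> L * (norm u / 2 ^ (n + k))"
      using g(1)[OF rR] rn[of "n + k"] L by (meson mult_left_mono order_trans)
    finally have "norm (s (n + Suc k) - s n)
        \<le> 2 * L * norm u * (1 / 2 ^ n - 1 / 2 ^ (n + k)) + L * (norm u / 2 ^ (n + k))"
      using Suc by linarith
    also have "\<dots> = 2 * L * norm u * (1 / 2 ^ n - 1 / 2 ^ (n + Suc k))"
      by (simp add: field_simps)
    finally show ?case .
  qed simp
  have diff': "norm (s m - s n) \<le> 2 * L * norm u * (1 / 2) ^ n" if mn: "m \<ge> n" for m n
  proof -
    obtain k where k: "m = n + k" using le_Suc_ex[OF mn] by blast
    have "2 * L * norm u * (1 / 2 ^ n - 1 / 2 ^ (n + k)) \<le> 2 * L * norm u * (1 / 2) ^ n"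
      using L by (intro mult_left_mono) (auto simp: power_divide)
    with diff[of n k] show ?thesis by (simp add: k)
  qed
  have "(\<lambda>n. 2 * L * norm u * (1 / 2) ^ n) \<longlonglongrightarrow> 2 * L * norm u * 0"
    by (intro tendsto_intros LIMSEQ_realpow_zero) auto
  then have small: "(\<lambda>n. 2 * L * norm u * (1 / 2) ^ n) \<longlonglongrightarrow> 0" by simp
  have "Cauchy s"
  proof (rule metric_CauchyI)
    fix e :: real assume e: "0 < e"
    obtain N where N: "2 * L * norm u * (1 / 2) ^ N < e / 2"
      using order_tendstoD(2)[OF small, of "e / 2"] e by (auto simp: eventually_sequentially)
    have "dist (s m) (s n) < e" if "m \<ge> N" "n \<ge> N" for m n
      using dist_triangle2[of "s m" "s n" "s N"] diff'[of N m] diff'[of N n] N that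
      by (simp add: dist_norm)
    then show "\<exists>M. \<forall>m\<ge>M. \<forall>n\<ge>M. dist (s m) (s n) < e" by blast
  qed
  then obtain w where w: "s \<longlonglongrightarrow> w"
    using Cauchy_convergent convergent_def by blast
  have "r \<longlonglongrightarrow> 0"
  proof (rule Lim_null_comparison)
    show "\<forall>\<^sub>F n in sequentially. norm (r n) \<le> norm u * (1 / 2) ^ n"
      using rn by (simp add: power_divide)
    have "(\<lambda>n. norm u * (1 / 2) ^ n) \<longlonglongrightarrow> norm u * 0"
      by (intro tendsto_intros LIMSEQ_realpow_zero) auto
    then show "(\<lambda>n. norm u * (1 / 2) ^ n) \<longlonglongrightarrow> 0" by simp
  qed
  then have "(\<lambda>n. T (s n)) \<longlonglongrightarrow> u"
    unfolding Ts using tendsto_diff[OF tendsto_const] by fastforce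
  then have "T w = u"
    using T.tendsto[OF w] LIMSEQ_unique by blast
  moreover have "norm w \<le> 2 * L * norm u"
  proof (rule LIMSEQ_le_const2[OF tendsto_norm[OF w]])
    show "\<exists>N. \<forall>n\<ge>N. norm (s n) \<le> 2 * L * norm u"
      using diff'[of 0] by (auto simp: s_def)
  qed
  ultimately show ?thesis by blast
qed

text \<open>
  The open mapping theorem for operators with closed range. The range is complete, so by Baire's
  theorem the closure of the image of some ball contains a ball of the range. By symmetry and convexity
  it contains one around the origin, and scaling yields the preimages up to half the norm
  required in \<open>bounded_preimages_of_approximate\<close>.
\<close>
lemma closed_range_bounded_preimages:
  fixes T :: "'y::{real_normed_vector, complete_space} \<Rightarrow> 'z::{real_normed_vector, complete_space}"
  assumes T: "bounded_linear T" and cl: "closed (range T)"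
  obtains K where "K \<ge> 0" "\<And>v. v \<in> range T \<Longrightarrow> \<exists>w. T w = v \<and> norm w \<le> K * norm v"
proof -
  interpret T: bounded_linear T by (rule T)
  let ?X = "top_of_set (range T)"
  define F where "F n = closure (T ` ball 0 (real n))" for n
  have FR: "F n \<subseteq> range T" for n
    unfolding F_def using cl by (intro closure_minimal) auto
  have "completely_metrizable_space ?X"
    using completely_metrizable_space_closedin[OF completely_metrizable_space_euclidean, of "range T"] cl
    by simp
  moreover have "closedin ?X (F n)" for n
    using FR by (intro closed_subset) (auto simp: F_def)
  moreover have "(\<Union>n. F n) = range T"
  proof
    show "range T \<subseteq> (\<Union>n. F n)"
    proof
      fix v assume "v \<in> range T"
      then obtain a where a: "v = T a" by blast
      obtain n where "norm a < real n" using reals_Archimedean2 by blast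
      then have "v \<in> T ` ball 0 (real n)" using a by auto
      then have "v \<in> F n" using closure_subset[of "T ` ball 0 (real n)"] by (auto simp: F_def)
      then show "v \<in> (\<Union>n. F n)" by blast
    qed
  qed (use FR in auto)
  then have "?X interior_of (\<Union>(range F)) = range T"
    using interior_of_topspace[of ?X] by simp
  then have "?X interior_of (\<Union>(range F)) \<noteq> {}" by auto
  ultimately have "\<exists>n. ?X interior_of (F n) \<noteq> {}"
    using Baire_category_alt[of ?X "range F"] by fastforce
  then obtain n where "?X interior_of (F n) \<noteq> {}" ..
  then obtain v U where U: "openin ?X U" "v \<in> U" "U \<subseteq> F n"
    by (auto simp: interior_of_def)
  then obtain e where e: "e > 0" "ball v e \<inter> range T \<subseteq> F n"
    unfolding openin_contains_ball by (meson order_trans)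
  have vR: "v \<in> range T" using U FR by blast
  have subR: "subspace (range T)"
    using T.linear_axioms by (intro linear_subspace_image) auto
  have near: "\<exists>a. norm a < real n \<and> norm (y - T a) < \<delta>" if "y \<in> F n" "\<delta> > 0" for y \<delta>
  proof -
    have "\<exists>z\<in>T ` ball 0 (real n). dist z y < \<delta>"
      using that unfolding F_def closure_approachable by blast
    then obtain a where "norm a < real n" "dist (T a) y < \<delta>" by auto
    then show ?thesis by (auto simp: dist_norm norm_minus_commute)
  qed
  have approx: "\<exists>a. norm a \<le> real n \<and> norm (y - T a) \<le> \<delta>"
    if y: "y \<in> range T" "norm y < e" and \<delta>: "\<delta> > 0" for y \<delta>
  proof -
    have "v + y \<in> range T" "v - y \<in> range T"
      using vR y(1) subR by (auto intro: subspace_add subspace_diff)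
    then have "v + y \<in> F n" "v - y \<in> F n"
      using y(2) by (simp_all add: subsetD[OF e(2)] dist_norm)
    then obtain a b where a: "norm a < real n" "norm (v + y - T a) < \<delta>"
        and b: "norm b < real n" "norm (v - y - T b) < \<delta>"
      using near[of "v + y" \<delta>] near[of "v - y" \<delta>] \<delta> by auto
    define c where "c = (1/2) *\<^sub>R (a - b)"
    have "norm c \<le> real n"
      using norm_triangle_ineq4[of a b] a b by (simp add: c_def)
    moreover have "2 *\<^sub>R (y - T c) = (v + y - T a) - (v - y - T b)"
      by (simp add: c_def T.scaleR T.diff scaleR_diff_right scaleR_2)
    then have "norm (2 *\<^sub>R (y - T c)) \<le> norm (v + y - T a) + norm (v - y - T b)"
      by (metis norm_triangle_ineq4)
    then have "norm (y - T c) \<le> \<delta>" using a b by simp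
    ultimately show ?thesis by blast
  qed
  define L where "L = 2 * real n / e"
  have "\<exists>a. norm a \<le> L * norm y \<and> norm (y - T a) \<le> norm y / 2" if y: "y \<in> range T" for y
  proof (cases "y = 0")
    case True
    then show ?thesis by (intro exI[of _ 0]) (simp add: T.zero)
  next
    case False
    \<comment> \<open>Scales y to norm e / 2, inside the ball in which images are dense.\<close>
    define t where "t = e / (2 * norm y)"
    have t: "t > 0" using e False by (simp add: t_def)
    have "t *\<^sub>R y \<in> range T" using y subR by (intro subspace_scale)
    moreover have "norm (t *\<^sub>R y) < e" using e False t by (simp add: t_def)
    ultimately obtain a where a: "norm a \<le> real n" "norm (t *\<^sub>R y - T a) \<le> e / 4"
      using approx[of "t *\<^sub>R y" "e / 4"] e by auto
    define b where "b = (1 / t) *\<^sub>R a"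
    have "norm b = norm a / t" using t by (simp add: b_def)
    also have "\<dots> \<le> real n / t" using a t by (simp add: divide_right_mono)
    also have "\<dots> = L * norm y" using e False by (simp add: t_def L_def)
    finally have "norm b \<le> L * norm y" .
    moreover have "y - T b = (1 / t) *\<^sub>R (t *\<^sub>R y - T a)"
      using t by (simp add: b_def T.scaleR scaleR_diff_right)
    then have "norm (y - T b) = norm (t *\<^sub>R y - T a) / t" using t by simp
    then have "norm (y - T b) \<le> (e / 4) / t"
      using divide_right_mono[OF a(2), of t] t by linarith
    then have "norm (y - T b) \<le> norm y / 2"
      using e False by (simp add: t_def)
    ultimately show ?thesis by blast
  qed
  note small_residual = this
  have "L \<ge> 0" using e by (simp add: L_def)
  then have "\<exists>w. T w = y \<and> norm w \<le> 2 * L * norm y" if "y \<in> range T" for y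
    by (rule bounded_preimages_of_approximate[OF T _ small_residual that])
  moreover have "2 * L \<ge> 0" using e by (simp add: L_def)
  ultimately show thesis using that[of "2 * L"] by blast
qed

section \<open>Stability of systems of affine equations and inequalities\<close>

text \<open>
  Robinson's upper Lipschitz property at 0 of a family \<open>S\<close> of perturbations of \<open>S 0\<close>. It covers infeasible
  limits: if \<open>S 0\<close> is empty, it says that \<open>S e\<close> is empty for all small \<open>e \<ge> 0\<close>.
\<close>
definition upper_lipschitz :: "(real \<Rightarrow> 'y::metric_space set) \<Rightarrow> bool" where
  "upper_lipschitz S \<longleftrightarrow> (\<exists>\<epsilon>>0. \<exists>c\<ge>0. \<forall>e. 0 \<le> e \<and> e \<le> \<epsilon> \<longrightarrow>
     (\<forall>z\<in>S e. \<exists>z'\<in>S 0. dist z z' \<le> c * e))"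

lemma upper_lipschitzE:
  assumes "upper_lipschitz S"
  obtains \<epsilon> c where "\<epsilon> > 0" "c \<ge> 0"
    "\<And>e z. 0 \<le> e \<Longrightarrow> e \<le> \<epsilon> \<Longrightarrow> z \<in> S e \<Longrightarrow> \<exists>z'\<in>S 0. dist z z' \<le> c * e"
  using assms unfolding upper_lipschitz_def by blast

lemma upper_lipschitzI:
  assumes "\<epsilon> > 0" "c \<ge> 0"
    "\<And>e z. 0 \<le> e \<Longrightarrow> e \<le> \<epsilon> \<Longrightarrow> z \<in> S e \<Longrightarrow> \<exists>z'\<in>S 0. dist z z' \<le> c * e"
  shows "upper_lipschitz S"
  using assms unfolding upper_lipschitz_def by blast

lemma upper_lipschitz_Un:
  assumes "upper_lipschitz S" "upper_lipschitz S'"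
  shows "upper_lipschitz (\<lambda>e. S e \<union> S' e)"
proof -
  obtain \<epsilon> c where 1: "\<epsilon> > 0" "c \<ge> 0"
    "\<And>e z. 0 \<le> e \<Longrightarrow> e \<le> \<epsilon> \<Longrightarrow> z \<in> S e \<Longrightarrow> \<exists>z'\<in>S 0. dist z z' \<le> c * e"
    using assms(1) by (rule upper_lipschitzE) metis
  obtain \<epsilon>' c' where 2: "\<epsilon>' > 0" "c' \<ge> 0"
    "\<And>e z. 0 \<le> e \<Longrightarrow> e \<le> \<epsilon>' \<Longrightarrow> z \<in> S' e \<Longrightarrow> \<exists>z'\<in>S' 0. dist z z' \<le> c' * e"
    using assms(2) by (rule upper_lipschitzE) metis
  show ?thesis
  proof (rule upper_lipschitzI)
    show "min \<epsilon> \<epsilon>' > 0" "max c c' \<ge> 0"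
      using 1 2 by auto
    fix e z assume e: "0 \<le> e" "e \<le> min \<epsilon> \<epsilon>'" and "z \<in> S e \<union> S' e"
    then obtain z' where "z' \<in> S 0 \<union> S' 0" "dist z z' \<le> c * e \<or> dist z z' \<le> c' * e"
      using 1(3)[of e z] 2(3)[of e z] by auto
    moreover have "c * e \<le> max c c' * e" "c' * e \<le> max c c' * e"
      using e by (auto intro: mult_right_mono)
    ultimately show "\<exists>z'\<in>S 0 \<union> S' 0. dist z z' \<le> max c c' * e"
      by (meson order_trans)
  qed
qed

lemma upper_lipschitz_UN:
  assumes "finite A" "\<And>I. I \<in> A \<Longrightarrow> upper_lipschitz (S I)"
  shows "upper_lipschitz (\<lambda>e. \<Union>I\<in>A. S I e)"
  using assms
proof (induction A)
  case empty
  show ?case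
    by (rule upper_lipschitzI[of 1 0]) auto
next
  case (insert I A)
  then show ?case
    using upper_lipschitz_Un[of "S I" "\<lambda>e. \<Union>I\<in>A. S I e"] by simp
qed

text \<open>
  A point of the perturbed set is moved to a point \<open>z1\<close> of \<open>S 0\<close>. If \<open>z1\<close> violates the inequality, the violation is
  of order \<open>e\<close>, hence \<open>z1\<close> nearly satisfies the corresponding equality and the bound for the
  equality moves it to a point of \<open>S 0\<close> that satisfies the inequality with equality. Thus bounds for
  inequality systems reduce to bounds for equality systems.
\<close>
lemma upper_lipschitz_inequality:
  assumes S: "upper_lipschitz S" and mono: "\<And>e. 0 \<le> e \<Longrightarrow> S 0 \<subseteq> S e"
    and eq: "upper_lipschitz (\<lambda>e. S e \<inter> {z. \<bar>f z - \<beta>\<bar> \<le> e})"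
    and lip: "\<And>z z'. \<bar>f z - f z'\<bar> \<le> L * dist z z'" "L \<ge> 0"
  shows "upper_lipschitz (\<lambda>e. S e \<inter> {z. f z \<le> \<beta> + e})"
proof -
  obtain \<epsilon> c where 1: "\<epsilon> > 0" "c \<ge> 0"
    "\<And>e z. 0 \<le> e \<Longrightarrow> e \<le> \<epsilon> \<Longrightarrow> z \<in> S e \<Longrightarrow> \<exists>z'\<in>S 0. dist z z' \<le> c * e"
    using S by (rule upper_lipschitzE) metis
  obtain \<epsilon>' c' where 2: "\<epsilon>' > 0" "c' \<ge> 0"
    "\<And>e z. 0 \<le> e \<Longrightarrow> e \<le> \<epsilon>' \<Longrightarrow> z \<in> S e \<inter> {z. \<bar>f z - \<beta>\<bar> \<le> e} \<Longrightarrow>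
      \<exists>z'\<in>S 0 \<inter> {z. \<bar>f z - \<beta>\<bar> \<le> 0}. dist z z' \<le> c' * e"
    using eq by (rule upper_lipschitzE) metis
  define K where "K = 1 + L * c"
  have K: "K \<ge> 1" using 1 lip by (simp add: K_def)
  show ?thesis
  proof (rule upper_lipschitzI)
    show "min \<epsilon> (\<epsilon>' / K) > 0" "c + c' * K \<ge> 0"
      using 1 2 K by auto
    fix e z assume e: "0 \<le> e" "e \<le> min \<epsilon> (\<epsilon>' / K)" and z: "z \<in> S e \<inter> {z. f z \<le> \<beta> + e}"
    have eK: "0 \<le> K * e" "K * e \<le> \<epsilon>'"
      using e K by (auto simp: field_simps)
    obtain z1 where z1: "z1 \<in> S 0" "dist z z1 \<le> c * e"
      using 1(3)[of e z] e z by auto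
    have c': "0 \<le> c' * (K * e)" using 2 eK by simp
    show "\<exists>z'\<in>S 0 \<inter> {z. f z \<le> \<beta> + 0}. dist z z' \<le> (c + c' * K) * e"
    proof (cases "f z1 \<le> \<beta>")
      case True
      then show ?thesis
        using z1 c' by (intro bexI[of _ z1]) (auto simp: algebra_simps)
    next
      case False
      have "f z1 - f z \<le> L * dist z z1" using lip(1)[of z z1] by linarith
      also have "\<dots> \<le> L * (c * e)" using z1 lip by (intro mult_left_mono) auto
      finally have "\<bar>f z1 - \<beta>\<bar> \<le> K * e"
        using False z by (auto simp: K_def algebra_simps)
      then obtain z2 where z2: "z2 \<in> S 0" "f z2 = \<beta>" "dist z1 z2 \<le> c' * (K * e)"
        using 2(3)[of "K * e" z1] mono[of "K * e"] eK z1 by auto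
      have "dist z z2 \<le> c * e + c' * (K * e)"
        using dist_triangle[of z z2 z1] z1 z2 by linarith
      then show ?thesis
        using z2 by (intro bexI[of _ z2]) (auto simp: algebra_simps)
    qed
  qed
qed

text \<open>
  If \<open>f\<close> varies on the affine set \<open>S 0\<close>, some direction \<open>d\<close> of that set has \<open>f d = 1\<close> and a step
  along \<open>d\<close> repairs the equation at a cost proportional to its residual. If \<open>f\<close> is constant on \<open>S 0\<close>, then
  either its value is \<open>\<beta>\<close> and nothing needs repair, or points with small residual do not exist.
\<close>
lemma upper_lipschitz_equality:
  fixes S :: "real \<Rightarrow> 'y::real_normed_vector set"
  assumes S: "upper_lipschitz S" and aff: "affine (S 0)" and f: "bounded_linear f"
  shows "upper_lipschitz (\<lambda>e. S e \<inter> {z. \<bar>f z - \<beta>\<bar> \<le> e})"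
proof -
  interpret f: bounded_linear f by (rule f)
  obtain L where L: "L \<ge> 0" "\<And>z. \<bar>f z\<bar> \<le> norm z * L"
    using f.nonneg_bounded by auto
  obtain \<epsilon> c where 1: "\<epsilon> > 0" "c \<ge> 0"
    "\<And>e z. 0 \<le> e \<Longrightarrow> e \<le> \<epsilon> \<Longrightarrow> z \<in> S e \<Longrightarrow> \<exists>z'\<in>S 0. dist z z' \<le> c * e"
    using S by (rule upper_lipschitzE) metis
  define K where "K = 1 + L * c"
  have K: "K \<ge> 1" using 1 L by (simp add: K_def)
  have near: "\<exists>z1\<in>S 0. dist z z1 \<le> c * e \<and> \<bar>f z1 - \<beta>\<bar> \<le> K * e"
    if e: "0 \<le> e" "e \<le> \<epsilon>" and z: "z \<in> S e" "\<bar>f z - \<beta>\<bar> \<le> e" for e z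
  proof -
    obtain z1 where z1: "z1 \<in> S 0" "dist z z1 \<le> c * e"
      using 1(3)[of e z] e z by auto
    have "\<bar>f z1 - f z\<bar> \<le> norm (z1 - z) * L"
      using L(2)[of "z1 - z"] by (simp add: f.diff)
    also have "\<dots> \<le> (c * e) * L"
      using z1 L by (intro mult_right_mono) (auto simp: dist_norm norm_minus_commute)
    finally show ?thesis
      using z z1 by (intro bexI[of _ z1]) (auto simp: K_def algebra_simps)
  qed
  show ?thesis
  proof (cases "\<exists>u\<in>S 0. \<exists>v\<in>S 0. f u \<noteq> f v")
    case True
    then obtain u v where uv: "u \<in> S 0" "v \<in> S 0" "f u \<noteq> f v" by blast
    define d where "d = (1 / (f u - f v)) *\<^sub>R (u - v)"
    have fd: "f d = 1" using uv by (simp add: d_def f.scaleR f.diff)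
    show ?thesis
    proof (rule upper_lipschitzI)
      show "\<epsilon> > 0" "c + K * norm d \<ge> 0" using 1 K by auto
      fix e z assume e: "0 \<le> e" "e \<le> \<epsilon>" and z: "z \<in> S e \<inter> {z. \<bar>f z - \<beta>\<bar> \<le> e}"
      obtain z1 where z1: "z1 \<in> S 0" "dist z z1 \<le> c * e" "\<bar>f z1 - \<beta>\<bar> \<le> K * e"
        using near[of e z] e z by auto
      define z2 where "z2 = z1 + (\<beta> - f z1) *\<^sub>R d"
      have "z2 = z1 + ((\<beta> - f z1) / (f u - f v)) *\<^sub>R (u - v)"
        by (simp add: z2_def d_def)
      then have "z2 \<in> S 0"
        using mem_affine_3_minus[OF aff z1(1) uv(1,2)] by simp
      moreover have "f z2 = \<beta>" by (simp add: z2_def f.add f.scaleR fd)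
      moreover have "dist z1 z2 \<le> K * e * norm d"
        using z1(3) by (auto simp: z2_def dist_norm abs_minus_commute intro: mult_right_mono)
      then have "dist z z2 \<le> (c + K * norm d) * e"
        using dist_triangle[of z z2 z1] z1(2) by (simp add: algebra_simps)
      ultimately show "\<exists>z'\<in>S 0 \<inter> {z. \<bar>f z - \<beta>\<bar> \<le> 0}. dist z z' \<le> (c + K * norm d) * e"
        by auto
    qed
  next
    case False
    show ?thesis
    proof (cases "\<exists>u\<in>S 0. f u \<noteq> \<beta>")
      case True
      then obtain u where u: "u \<in> S 0" "f u \<noteq> \<beta>" by blast
      show ?thesis
      proof (rule upper_lipschitzI)
        define \<delta> where "\<delta> = \<bar>f u - \<beta>\<bar> / (2 * K)"
        show "min \<epsilon> \<delta> > 0" "(0::real) \<le> 0" using 1 u K by (auto simp: \<delta>_def)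
        fix e z assume e: "0 \<le> e" "e \<le> min \<epsilon> \<delta>" and z: "z \<in> S e \<inter> {z. \<bar>f z - \<beta>\<bar> \<le> e}"
        obtain z1 where z1: "z1 \<in> S 0" "\<bar>f z1 - \<beta>\<bar> \<le> K * e"
          using near[of e z] e z by auto
        have "f z1 = f u" using False u z1 by blast
        moreover have "K * e \<le> \<bar>f u - \<beta>\<bar> / 2"
          using e K by (auto simp: \<delta>_def field_simps)
        ultimately have False using z1 u by auto
        then show "\<exists>z'\<in>S 0 \<inter> {z. \<bar>f z - \<beta>\<bar> \<le> 0}. dist z z' \<le> 0 * e" ..
      qed
    next
      case False
      then show ?thesis
        using 1 by (intro upper_lipschitzI[of \<epsilon> c]) fastforce+
    qed
  qed
qed

text \<open>
  A local form of Hoffman's lemma. The equations \<open>E\<close> are arbitrary in the induction on the inequalities \<open>J\<close>,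
  because each inequality is handled by also treating it as an equation.
\<close>
theorem upper_lipschitz_affine_system:
  fixes f :: "'i \<Rightarrow> 'y::real_normed_vector \<Rightarrow> real"
  assumes S: "upper_lipschitz S" and aff: "affine (S 0)" and mono: "\<And>e. 0 \<le> e \<Longrightarrow> S 0 \<subseteq> S e"
    and f: "\<And>j. bounded_linear (f j)" and "finite E" "finite J"
  shows "upper_lipschitz
    (\<lambda>e. S e \<inter> {z. (\<forall>j\<in>E. \<bar>f j z - \<beta> j\<bar> \<le> e) \<and> (\<forall>j\<in>J. f j z \<le> \<beta> j + e)})"
  using \<open>finite J\<close> \<open>finite E\<close>
proof (induction J arbitrary: E)
  case empty
  from empty show ?case
  proof (induction E)
    case empty
    then show ?case using S by simp
  next
    case (insert j E)
    let ?S = "\<lambda>e. S e \<inter> {z. \<forall>j\<in>E. \<bar>f j z - \<beta> j\<bar> \<le> e}"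
    have "affine {z. f k z = \<beta> k}" for k
    proof -
      interpret bounded_linear "f k" by (rule f)
      show ?thesis
        by (auto simp: affine_def add scaleR simp flip: distrib_right)
    qed
    then have "affine (S 0 \<inter> (\<Inter>k\<in>E. {z. f k z = \<beta> k}))"
      using aff by (intro affine_Int affine_Inter) auto
    moreover have "?S 0 = S 0 \<inter> (\<Inter>k\<in>E. {z. f k z = \<beta> k})" by auto
    ultimately have "affine (?S 0)" by metis
    with insert.IH have "upper_lipschitz (\<lambda>e. ?S e \<inter> {z. \<bar>f j z - \<beta> j\<bar> \<le> e})"
      by (intro upper_lipschitz_equality f) auto
    moreover have "(\<lambda>e. ?S e \<inter> {z. \<bar>f j z - \<beta> j\<bar> \<le> e}) =
        (\<lambda>e. S e \<inter> {z. (\<forall>j\<in>insert j E. \<bar>f j z - \<beta> j\<bar> \<le> e) \<and> (\<forall>j\<in>{}. f j z \<le> \<beta> j + e)})"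
      by (intro ext) auto
    ultimately show ?case by metis
  qed
next
  case (insert j J)
  let ?S = "\<lambda>E e. S e \<inter> {z. (\<forall>j\<in>E. \<bar>f j z - \<beta> j\<bar> \<le> e) \<and> (\<forall>j\<in>J. f j z \<le> \<beta> j + e)}"
  interpret fj: bounded_linear "f j" by (rule f)
  obtain L where L: "L \<ge> 0" "\<And>z. \<bar>f j z\<bar> \<le> norm z * L"
    using fj.nonneg_bounded by auto
  have eq: "?S (insert j E) = (\<lambda>e. ?S E e \<inter> {z. \<bar>f j z - \<beta> j\<bar> \<le> e})"
    by (intro ext) auto
  have "upper_lipschitz (\<lambda>e. ?S E e \<inter> {z. f j z \<le> \<beta> j + e})"
  proof (rule upper_lipschitz_inequality)
    show "upper_lipschitz (?S E)"
      using insert.IH insert.prems .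
    show "upper_lipschitz (\<lambda>e. ?S E e \<inter> {z. \<bar>f j z - \<beta> j\<bar> \<le> e})"
      using insert.IH[of "insert j E"] insert.prems eq by (metis finite.insertI)
    show "?S E 0 \<subseteq> ?S E e" if "0 \<le> e" for e
      using that mono[OF that] by fastforce
    show "\<bar>f j z - f j z'\<bar> \<le> L * dist z z'" for z z'
      using L(2)[of "z - z'"] by (simp add: fj.diff dist_norm mult.commute)
  qed (rule L)
  moreover have "(\<lambda>e. ?S E e \<inter> {z. f j z \<le> \<beta> j + e}) =
      (\<lambda>e. S e \<inter> {z. (\<forall>j\<in>E. \<bar>f j z - \<beta> j\<bar> \<le> e) \<and> (\<forall>j\<in>insert j J. f j z \<le> \<beta> j + e)})"
    by (intro ext) auto
  ultimately show ?case by metis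
qed

text \<open>
  For \<open>b\<close> in the range, a bounded preimage of the residual corrects \<open>z\<close>. For \<open>b\<close> outside the closed range,
  the residual is bounded away from zero.
\<close>
lemma upper_lipschitz_linear_equation:
  fixes T :: "'y::{real_normed_vector, complete_space} \<Rightarrow> 'z::{real_normed_vector, complete_space}"
  assumes T: "bounded_linear T" and cl: "closed (range T)"
  shows "upper_lipschitz (\<lambda>e. {z. norm (T z - b) \<le> e})"
proof (cases "b \<in> range T")
  case True
  interpret T: bounded_linear T by (rule T)
  obtain K where K: "K \<ge> 0" "\<And>v. v \<in> range T \<Longrightarrow> \<exists>w. T w = v \<and> norm w \<le> K * norm v"
    using closed_range_bounded_preimages[OF T cl] by blast
  show ?thesis
  proof (rule upper_lipschitzI[of 1 K])
    fix e :: real and z assume z: "z \<in> {z. norm (T z - b) \<le> e}"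
    obtain y where y: "b = T y" using True by blast
    have "T z - b \<in> range T" using T.diff[of z y] y by (metis rangeI)
    then obtain w where w: "T w = T z - b" "norm w \<le> K * norm (T z - b)"
      using K(2) by blast
    have "norm w \<le> K * e"
      using w(2) z mult_left_mono[OF _ K(1), of "norm (T z - b)" e] by simp
    then show "\<exists>z'\<in>{z. norm (T z - b) \<le> 0}. dist z z' \<le> K * e"
      using w(1) by (intro bexI[of _ "z - w"]) (auto simp: T.diff dist_norm)
  qed (use K in auto)
next
  case False
  then obtain d where d: "d > 0" "ball b d \<subseteq> - range T"
    using cl unfolding closed_def open_contains_ball by blast
  show ?thesis
  proof (rule upper_lipschitzI)
    show "d / 2 > 0" "(0::real) \<le> 0" using d by auto
    fix e z assume "e \<le> d / 2" "z \<in> {z. norm (T z - b) \<le> e}"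
    then have "T z \<in> ball b d" using d(1) by (simp add: dist_norm norm_minus_commute)
    with d(2) show "\<exists>z'\<in>{z. norm (T z - b) \<le> 0}. dist z z' \<le> 0 * e" by blast
  qed
qed

section \<open>Normal cones of polyhedra\<close>

text \<open>
  Farkas' lemma by Bartl's algebraic induction. If the constraint \<open>j\<close> is really used, some \<open>d\<close> violates only it;
  projecting along \<open>d\<close> onto the kernel of \<open>a j\<close> eliminates the constraint, and the multiplier of \<open>a j\<close> is recovered by evaluation at \<open>d\<close>.
\<close>
lemma farkas:
  fixes a :: "'i \<Rightarrow> 'a::real_inner"
  assumes "finite I"
    and "\<And>d. (\<forall>i\<in>I. inner (a i) d \<le> 0) \<Longrightarrow> inner w d \<le> 0"
  shows "\<exists>l. (\<forall>i\<in>I. 0 \<le> l i) \<and> w = (\<Sum>i\<in>I. l i *\<^sub>R a i)"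
  using assms
proof (induction I arbitrary: a w)
  case empty
  from empty[of w] have "w = 0"
    using inner_gt_zero_iff[of w] by (simp add: not_less[symmetric])
  then show ?case by simp
next
  case (insert j I)
  show ?case
  proof (cases "\<forall>d. (\<forall>i\<in>I. inner (a i) d \<le> 0) \<longrightarrow> inner w d \<le> 0")
    case True
    then obtain l where l: "\<forall>i\<in>I. 0 \<le> l i" "w = (\<Sum>i\<in>I. l i *\<^sub>R a i)"
      using insert.IH[of a w] by blast
    have "w = (\<Sum>i\<in>insert j I. (l(j := 0)) i *\<^sub>R a i)"
      using insert.hyps l(2) by (simp, intro sum.cong) auto
    with l(1) show ?thesis by (intro exI[of _ "l(j := 0)"]) auto
  next
    case False
    then obtain d0 where d0: "\<forall>i\<in>I. inner (a i) d0 \<le> 0" "inner w d0 > 0"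
      by force
    with insert.prems[of d0] have j0: "inner (a j) d0 > 0" by force
    define d where "d = (1 / inner (a j) d0) *\<^sub>R d0"
    have d: "\<forall>i\<in>I. inner (a i) d \<le> 0" "inner w d > 0" "inner (a j) d = 1"
      using d0 j0 by (auto simp: d_def divide_nonpos_pos)
    define a' where "a' i = a i - inner (a i) d *\<^sub>R a j" for i
    define w' where "w' = w - inner w d *\<^sub>R a j"
    have "inner w' x \<le> 0" if x: "\<forall>i\<in>I. inner (a' i) x \<le> 0" for x
    proof -
      define x' where "x' = x - inner (a j) x *\<^sub>R d"
      have "inner (a i) x' = inner (a' i) x" for i
        by (simp add: x'_def a'_def inner_diff_left inner_diff_right)
      moreover have "inner w x' = inner w' x"
        by (simp add: x'_def w'_def inner_diff_left inner_diff_right)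
      moreover have "inner (a j) x' = 0"
        using d by (simp add: x'_def inner_diff_right)
      ultimately show ?thesis using insert.prems[of x'] x by auto
    qed
    then obtain l where l: "\<forall>i\<in>I. 0 \<le> l i" "w' = (\<Sum>i\<in>I. l i *\<^sub>R a' i)"
      using insert.IH[of a' w'] by blast
    define lj where "lj = inner w d - (\<Sum>i\<in>I. l i * inner (a i) d)"
    have "(\<Sum>i\<in>I. l i * inner (a i) d) \<le> 0"
      using l(1) d(1) by (intro sum_nonpos) (auto intro: mult_nonneg_nonpos)
    then have lj: "lj \<ge> 0" using d by (simp add: lj_def)
    have "w = w' + inner w d *\<^sub>R a j" by (simp add: w'_def)
    also have "w' = (\<Sum>i\<in>I. l i *\<^sub>R a i) - (\<Sum>i\<in>I. l i * inner (a i) d) *\<^sub>R a j"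
      by (simp add: l(2) a'_def scaleR_diff_right sum_subtractf scaleR_sum_left)
    finally have w: "w = lj *\<^sub>R a j + (\<Sum>i\<in>I. l i *\<^sub>R a i)"
      by (simp add: lj_def algebra_simps)
    have "(\<Sum>i\<in>I. (l(j := lj)) i *\<^sub>R a i) = (\<Sum>i\<in>I. l i *\<^sub>R a i)"
      using insert.hyps by (intro sum.cong) auto
    with w insert.hyps have "w = (\<Sum>i\<in>insert j I. (l(j := lj)) i *\<^sub>R a i)"
      by simp
    with l(1) lj show ?thesis by (intro exI[of _ "l(j := lj)"]) auto
  qed
qed

text \<open>
  Normal vectors are nonnegative combinations of the active constraint vectors: every direction that is
  admissible for the active constraints leads into the polyhedron for a short while, since the inactive ones have
  slack, and so Farkas' lemma applies. Setting the other multipliers to zero gives complementary slackness.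
\<close>
lemma polyhedron_normal_cone:
  fixes a :: "'i \<Rightarrow> 'a::real_inner"
  assumes A: "finite A" and p: "\<And>i. i \<in> A \<Longrightarrow> inner (a i) p \<le> \<alpha> i"
    and w: "\<And>y. (\<forall>i\<in>A. inner (a i) y \<le> \<alpha> i) \<Longrightarrow> inner w (y - p) \<le> 0"
  shows "\<exists>l. (\<forall>i\<in>A. 0 \<le> l i \<and> (inner (a i) p \<noteq> \<alpha> i \<longrightarrow> l i = 0)) \<and> w = (\<Sum>i\<in>A. l i *\<^sub>R a i)"
proof -
  define I where "I = {i\<in>A. inner (a i) p = \<alpha> i}"
  have "inner w d \<le> 0" if d: "\<forall>i\<in>I. inner (a i) d \<le> 0" for d
  proof -
    have "\<forall>\<^sub>F t in at_right (0::real). inner (a i) (p + t *\<^sub>R d) \<le> \<alpha> i" if i: "i \<in> A" for i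
    proof (cases "i \<in> I")
      case True
      then have "inner (a i) (p + t *\<^sub>R d) \<le> \<alpha> i" if "t > 0" for t
        using d that by (auto simp: I_def inner_add_right mult_nonneg_nonpos)
      then show ?thesis
        by (auto simp: eventually_at_filter)
    next
      case False
      have "((\<lambda>t. inner (a i) (p + t *\<^sub>R d)) \<longlongrightarrow> inner (a i) (p + 0 *\<^sub>R d)) (at_right 0)"
        by (intro tendsto_intros)
      moreover have "inner (a i) (p + 0 *\<^sub>R d) < \<alpha> i"
        using False i p[OF i] by (simp add: I_def)
      ultimately show ?thesis
        using order_tendstoD(2) eventually_mono less_imp_le by (smt (verit))
    qed
    then have "\<forall>\<^sub>F t in at_right (0::real). \<forall>i\<in>A. inner (a i) (p + t *\<^sub>R d) \<le> \<alpha> i"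
      using A by (simp add: eventually_ball_finite)
    then have "\<forall>\<^sub>F t in at_right (0::real). t > 0 \<and> (\<forall>i\<in>A. inner (a i) (p + t *\<^sub>R d) \<le> \<alpha> i)"
      by (intro eventually_conj eventually_at_right_less)
    then obtain t :: real where "t > 0" "\<forall>i\<in>A. inner (a i) (p + t *\<^sub>R d) \<le> \<alpha> i"
      using eventually_happens by force
    with w[of "p + t *\<^sub>R d"] show ?thesis by (simp add: mult_le_0_iff)
  qed
  moreover have "finite I" using A by (simp add: I_def)
  ultimately obtain l where l: "\<forall>i\<in>I. 0 \<le> l i" "w = (\<Sum>i\<in>I. l i *\<^sub>R a i)"
    using farkas[of I a w] by blast
  define l' where "l' i = (if i \<in> I then l i else 0)" for i
  have "w = (\<Sum>i\<in>A. l' i *\<^sub>R a i)"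
    unfolding l(2) using A by (intro sum.mono_neutral_cong_left) (auto simp: l'_def I_def)
  then show ?thesis
    using l(1) by (intro exI[of _ l']) (auto simp: l'_def I_def)
qed

section \<open>The error bound\<close>

lemma bounded_linear_apply_bcontfun: "bounded_linear (\<lambda>l :: 'b::topological_space \<Rightarrow>\<^sub>C real. l i)"
proof (rule bounded_linear_intro[where K = 1])
  show "norm (l i) \<le> norm l * 1" for l :: "'b \<Rightarrow>\<^sub>C real"
    using norm_bounded[of l i] by simp
qed simp_all

text \<open>
  Bounded functions on a discrete index set form a Banach space, so they can serve as vectors of multipliers
  whose number is not fixed by a type; a finite family of multipliers embeds by cutting off outside \<open>A\<close>.
\<close>
lemma finite_restriction_bcontfun:
  fixes l :: "'i \<Rightarrow> real"
  assumes "finite A"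
  shows "\<exists>l' :: 'i discrete \<Rightarrow>\<^sub>C real. \<forall>i\<in>A. l' (discrete i) = l i"
proof -
  let ?f = "\<lambda>k. if of_discrete k \<in> A then l (of_discrete k) else 0"
  have "?f \<in> bcontfun"
  proof (rule bcontfun_normI)
    show "continuous_on UNIV ?f"
      by (auto simp: continuous_on_open_vimage open_discrete)
    show "norm (?f k) \<le> (\<Sum>j\<in>A. \<bar>l j\<bar>)" for k
      using assms member_le_sum[of "of_discrete k" A "\<lambda>j. \<bar>l j\<bar>"] by (auto intro: sum_nonneg)
  qed
  then obtain l' where l': "?f = apply_bcontfun l'"
    by (rule bcontfunE)
  have "l' (discrete i) = l i" if "i \<in> A" for i
    using fun_cong[OF l', of "discrete i"] that by (simp add: discrete_inverse)
  then show ?thesis by blast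
qed

theorem theorem2p2:
  fixes M :: "'a::{real_inner, complete_space} \<Rightarrow> 'a"
    and q :: 'a
    and C :: "'a set"
    and m :: nat
    and xs :: "nat \<Rightarrow> 'a"
    and \<alpha> :: "nat \<Rightarrow> real"
  assumes "bounded_linear M"
    and "closed (range M)"
    and "C = {x. \<forall>i\<in>{1..m}. inner (xs i) x \<le> \<alpha> i}"
    and "C \<noteq> {}"
  shows "\<exists>\<epsilon> c :: real. \<epsilon> > 0 \<and> c > 0 \<and>
    (\<forall>x. norm (x - metric_proj C (x - M x - q)) \<le> \<epsilon> \<longrightarrow>
      ext_infdist x (avi_solutions M q C)
        \<le> ereal (c * norm (x - metric_proj C (x - M x - q))))"
proof -
  interpret M: bounded_linear M by (rule assms(1))
  define A where "A = {1..m}"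
  have A: "finite A" and C: "C = {x. \<forall>i\<in>A. inner (xs i) x \<le> \<alpha> i}"
    using assms(3) by (auto simp: A_def)
  \<comment> \<open>The left-hand side of the stationarity equation M x + (sum of l i * xs i) = - q.\<close>
  define T :: "'a \<times> (nat discrete \<Rightarrow>\<^sub>C real) \<Rightarrow> 'a"
    where "T z = M (fst z) + (\<Sum>i\<in>A. apply_bcontfun (snd z) (discrete i) *\<^sub>R xs i)" for z
  \<comment> \<open>Constraint functionals: (True, i) is the i-th primal constraint, (False, i) the sign of the multiplier.\<close>
  define f :: "bool \<times> nat \<Rightarrow> 'a \<times> (nat discrete \<Rightarrow>\<^sub>C real) \<Rightarrow> real"
    where "f j z = (if fst j then inner (xs (snd j)) (fst z) else - apply_bcontfun (snd z) (discrete (snd j)))" for j z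
  define \<beta> where "\<beta> j = (if fst j then \<alpha> (snd j) else 0)" for j :: "bool \<times> nat"
  \<comment> \<open>For the active set I, primal constraints in I and signs outside I are equations.\<close>
  define E where "E I = Pair True ` I \<union> Pair False ` (A - I)" for I
  define S where "S I e = {z. norm (T z - (- q)) \<le> e} \<inter>
    {z. (\<forall>j\<in>E I. \<bar>f j z - \<beta> j\<bar> \<le> e) \<and> (\<forall>j\<in>UNIV \<times> A. f j z \<le> \<beta> j + e)}" for I e
  \<comment> \<open>S I 0 is the KKT system with active set I, and S I e its relaxation by e.\<close>
  have mem_S: "z \<in> S I e \<longleftrightarrow> norm (T z + q) \<le> e \<and>
      (\<forall>i\<in>I. \<bar>inner (xs i) (fst z) - \<alpha> i\<bar> \<le> e) \<and>
      (\<forall>i\<in>A - I. \<bar>apply_bcontfun (snd z) (discrete i)\<bar> \<le> e) \<and>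
      (\<forall>i\<in>A. inner (xs i) (fst z) \<le> \<alpha> i + e \<and> - apply_bcontfun (snd z) (discrete i) \<le> e)"
    for z I e
    unfolding S_def E_def f_def \<beta>_def by (auto simp: ball_Un split: if_splits)
  have bl: "bounded_linear (\<lambda>z :: 'a \<times> (nat discrete \<Rightarrow>\<^sub>C real). apply_bcontfun (snd z) (discrete i))" for i
    using bounded_linear_compose[OF bounded_linear_apply_bcontfun bounded_linear_snd] .
  have T: "bounded_linear T"
  proof -
    have "bounded_linear (\<lambda>z :: 'a \<times> (nat discrete \<Rightarrow>\<^sub>C real). apply_bcontfun (snd z) (discrete i) *\<^sub>R xs i)" for i
      using bounded_linear_compose[OF bounded_linear_scaleR_left bl] .
    moreover have "bounded_linear (\<lambda>z :: 'a \<times> (nat discrete \<Rightarrow>\<^sub>C real). M (fst z))"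
      using bounded_linear_compose[OF assms(1) bounded_linear_fst] .
    ultimately show ?thesis
      unfolding T_def[abs_def] by (intro bounded_linear_add bounded_linear_sum)
  qed
  interpret T: bounded_linear T by (rule T)
  have f: "bounded_linear (f j)" for j
  proof (cases "fst j")
    case True
    then show ?thesis
      using bounded_linear_compose[OF bounded_linear_inner_right bounded_linear_fst]
      by (simp add: f_def[abs_def])
  next
    case False
    then show ?thesis
      using bounded_linear_minus[OF bl] by (simp add: f_def[abs_def])
  qed
  have "range T = span (range M \<union> xs ` A)"
  proof
    show "range T \<subseteq> span (range M \<union> xs ` A)"
      by (auto simp: T_def intro!: span_add span_sum span_scale intro: span_base)
    have "M x \<in> range T" for x
      by (rule range_eqI[of _ _ "(x, 0)"]) (simp add: T_def)
    moreover have "xs i \<in> range T" if "i \<in> A" for i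
    proof -
      obtain l :: "nat discrete \<Rightarrow>\<^sub>C real" where "\<forall>k\<in>A. l (discrete k) = (if k = i then 1 else 0)"
        using finite_restriction_bcontfun[OF A, of "\<lambda>k. if k = i then 1 else 0"] by blast
      then have "(\<Sum>k\<in>A. l (discrete k) *\<^sub>R xs k) = (\<Sum>k\<in>A. if k = i then xs k else 0)"
        by (intro sum.cong) auto
      then have "T (0, l) = xs i" using that A by (simp add: T_def M.zero)
      then show ?thesis by (metis rangeI)
    qed
    ultimately show "span (range M \<union> xs ` A) \<subseteq> range T"
      using T.linear_axioms by (intro span_minimal) (auto intro!: linear_subspace_image)
  qed
  moreover have "span (range M) = range M"
    using M.linear_axioms by (simp only: span_eq_iff) (intro linear_subspace_image, auto)
  ultimately have "closed (range T)"
    using closed_span_Un_finite[of "range M" "xs ` A"] assms(2) finite_imageI[OF A] by metis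
  then have base: "upper_lipschitz (\<lambda>e. {z. norm (T z - (- q)) \<le> e})"
    by (rule upper_lipschitz_linear_equation[OF T])
  have aff: "affine {z. norm (T z - (- q)) \<le> 0}"
  proof -
    have "u *\<^sub>R T x + v *\<^sub>R T y + q = 0" if "T x + q = 0" "T y + q = 0" "u + v = 1" for x y and u v :: real
    proof -
      have "T x = - q" "T y = - q" using that by (auto simp: eq_neg_iff_add_eq_0)
      moreover have "u *\<^sub>R (- q) + v *\<^sub>R (- q) = (u + v) *\<^sub>R (- q)"
        by (simp only: scaleR_add_left)
      ultimately show ?thesis using that(3) by simp
    qed
    then show ?thesis by (auto simp: affine_def T.add T.scaleR)
  qed
  have "upper_lipschitz (S I)" if "I \<in> Pow A" for I
    unfolding S_def[abs_def]
  proof (rule upper_lipschitz_affine_system[OF base aff _ f])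
    show "finite (E I)"
      using that A finite_subset[of I A] by (auto simp: E_def)
  qed (use A in auto)
  then obtain \<epsilon> c where \<epsilon>: "\<epsilon> > 0" "c \<ge> 0"
    and near: "\<And>e z. 0 \<le> e \<Longrightarrow> e \<le> \<epsilon> \<Longrightarrow> z \<in> (\<Union>I\<in>Pow A. S I e) \<Longrightarrow>
      \<exists>z'\<in>(\<Union>I\<in>Pow A. S I 0). dist z z' \<le> c * e"
    using upper_lipschitz_UN[of "Pow A" S] A by (auto elim!: upper_lipschitzE)
  have sol: "fst z \<in> avi_solutions M q C" if I: "I \<subseteq> A" and z: "z \<in> S I 0" for I z
  proof -
    have eqs: "M (fst z) + q = - (\<Sum>i\<in>A. apply_bcontfun (snd z) (discrete i) *\<^sub>R xs i)"
      using z by (simp add: mem_S T_def algebra_simps eq_neg_iff_add_eq_0)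
    have feas: "inner (xs i) (fst z) \<le> \<alpha> i" "0 \<le> apply_bcontfun (snd z) (discrete i)" if "i \<in> A" for i
      using z that by (simp_all add: mem_S)
    have act: "i \<in> I \<Longrightarrow> inner (xs i) (fst z) = \<alpha> i" and inact: "i \<in> A - I \<Longrightarrow> apply_bcontfun (snd z) (discrete i) = 0" for i
      using z by (simp_all add: mem_S)
    have "inner (M (fst z) + q) (y - fst z) \<ge> 0" if y: "y \<in> C" for y
    proof -
      have "apply_bcontfun (snd z) (discrete i) * inner (xs i) (y - fst z) \<le> 0" if "i \<in> A" for i
        using feas[OF that] act[of i] inact[of i] y that C
        by (cases "i \<in> I") (auto simp: inner_diff_right intro: mult_nonneg_nonpos)
      then show ?thesis
        unfolding eqs by (simp add: inner_sum_left sum_nonpos)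
    qed
    then show ?thesis using feas by (auto simp: avi_solutions_def C)
  qed
  have "closed C"
  proof -
    have "C = (\<Inter>i\<in>A. {x. inner (xs i) x \<le> \<alpha> i})" using C by auto
    then show ?thesis by (auto intro!: closed_INT closed_halfspace_le)
  qed
  moreover have "convex C"
  proof -
    have "C = (\<Inter>i\<in>A. {x. inner (xs i) x \<le> \<alpha> i})" using C by auto
    then show ?thesis by (auto intro!: convex_INT convex_halfspace_le)
  qed
  ultimately have proj: "metric_proj C u \<in> C"
      "\<And>y. y \<in> C \<Longrightarrow> inner (u - metric_proj C u) (y - metric_proj C u) \<le> 0" for u
    using metric_proj_in_and_variational assms(4) by blast+
  \<comment> \<open>K turns the size of the residual vector r into a bound for all perturbations it causes.\<close>
  define K where "K = 1 + (\<Sum>i\<in>A. norm (xs i))"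
  have K1: "K \<ge> 1" by (simp add: K_def sum_nonneg)
  have Kxs: "norm (xs i) \<le> K" if "i \<in> A" for i
    using member_le_sum[of i A "\<lambda>i. norm (xs i)"] that A by (simp add: K_def)
  show ?thesis
  proof (intro exI conjI allI impI)
    show "\<epsilon> / K > 0" "c * K + 1 > 0" using \<epsilon> K1 by (auto intro: add_nonneg_pos)
    fix x
    define p where "p = metric_proj C (x - M x - q)"
    \<comment> \<open>Stationarity holds at x up to r; feasibility and complementarity hold exactly at p = x - r.\<close>
    define r where "r = x - p"
    assume "norm (x - metric_proj C (x - M x - q)) \<le> \<epsilon> / K"
    then have re: "K * norm r \<le> \<epsilon>" using K1 by (simp add: r_def p_def field_simps)
    have pC: "inner (xs i) p \<le> \<alpha> i" if "i \<in> A" for i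
      using proj(1) that by (auto simp: p_def C)
    have "inner (x - M x - q - p) (y - p) \<le> 0" if "\<forall>i\<in>A. inner (xs i) y \<le> \<alpha> i" for y
      unfolding p_def using that by (intro proj(2)) (simp add: C)
    then obtain l where l: "\<And>i. i \<in> A \<Longrightarrow> 0 \<le> l i"
        "\<And>i. i \<in> A \<Longrightarrow> inner (xs i) p \<noteq> \<alpha> i \<Longrightarrow> l i = 0"
        and suml: "x - M x - q - p = (\<Sum>i\<in>A. l i *\<^sub>R xs i)"
      using polyhedron_normal_cone[OF A, of xs p \<alpha> "x - M x - q - p"] pC by blast
    obtain l' :: "nat discrete \<Rightarrow>\<^sub>C real" where l': "\<And>i. i \<in> A \<Longrightarrow> l' (discrete i) = l i"
      using finite_restriction_bcontfun[OF A, of l] by blast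
    define I where "I = {i\<in>A. inner (xs i) p = \<alpha> i}"
    have x: "x = p + r" by (simp add: r_def)
    have rK: "norm r \<le> K * norm r" using mult_right_mono[OF K1, of "norm r"] by simp
    have ir: "\<bar>inner (xs i) r\<bar> \<le> K * norm r" if "i \<in> A" for i
      using Cauchy_Schwarz_ineq2[of "xs i" r] Kxs[OF that]
        mult_right_mono[of "norm (xs i)" K "norm r"] by simp
    have K0: "0 \<le> K * norm r" using rK norm_ge_zero[of r] by linarith
    have "(x, l') \<in> S I (K * norm r)"
    proof -
      have "(\<Sum>i\<in>A. l' (discrete i) *\<^sub>R xs i) = x - M x - q - p"
        using suml l' by simp
      then have "T (x, l') + q = r" by (simp add: T_def r_def)
      then have "norm (T (x, l') + q) \<le> K * norm r" using rK by simp
      moreover have "inner (xs i) x - \<alpha> i = inner (xs i) p - \<alpha> i + inner (xs i) r" for i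
        by (simp add: x inner_add_right)
      then have "\<forall>i\<in>I. \<bar>inner (xs i) x - \<alpha> i\<bar> \<le> K * norm r"
        and "\<forall>i\<in>A. inner (xs i) x \<le> \<alpha> i + K * norm r"
        using ir pC by (force simp: I_def abs_le_iff)+
      moreover have "\<forall>i\<in>A - I. l' (discrete i) = 0" "\<forall>i\<in>A. 0 \<le> l' (discrete i)"
        using l l' by (auto simp: I_def)
      ultimately show ?thesis
        using K0 by (fastforce simp: mem_S)
    qed
    moreover have "I \<in> Pow A" by (auto simp: I_def)
    ultimately have "(x, l') \<in> (\<Union>I\<in>Pow A. S I (K * norm r))" by blast
    from near[OF K0 re this]
    obtain z' where z': "z' \<in> (\<Union>I\<in>Pow A. S I 0)" "dist (x, l') z' \<le> c * (K * norm r)"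
      by blast
    have "norm (x - fst z') \<le> c * (K * norm r)"
      using dist_fst_le[of "(x, l')" z'] z'(2) by (simp add: dist_norm)
    then have "norm (x - fst z') \<le> c * (K * norm r) + norm r"
      using norm_ge_zero[of r] by linarith
    then have dist: "norm (x - fst z') \<le> (c * K + 1) * norm r"
      by (simp add: distrib_right mult.assoc)
    have "ext_infdist x (avi_solutions M q C) \<le> ereal (norm (x - fst z'))"
      unfolding ext_infdist_def using z'(1) sol by (intro INF_lower) blast
    also have "\<dots> \<le> ereal ((c * K + 1) * norm r)"
      using dist by simp
    finally show "ext_infdist x (avi_solutions M q C)
        \<le> ereal ((c * K + 1) * norm (x - metric_proj C (x - M x - q)))"
      by (simp add: r_def p_def)
  qed
qed

end
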